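(* Let $G=(V,E)$ be a $d$-regular graph on $n$ vertices with $\lambda<d$, where $\lambda$ is as defined in the context. Run the Random Growth process on $G$, and let $t=\pi n$ be the number of steps completed. Then the expected density $\kappa=|Q_t|/n$ of the queue at step $t$ satisfies \[\mathbb{E}(\kappa) \ \geq \ 1 - \pi - \exp \left(-\left(d - \lambda\right)\left(1 + \frac{1}{d - 1}\right) \pi \right) \enspace . \]
   Context: For a graph $G$ with adjacency matrix $A$ having eigenvalues $\lambda_1\geq\dots\geq\lambda_n$, set $\lambda=\max\{|\lambda_2|,|\lambda_n|\}$. Random Growth process on a connected graph $G$ with start vertex $v_1$: maintain a partition of $V$ into $P$ (processed), $Q$ (queue), $U$ (unvisited); initially $P=\emptyset$, $Q=\{v_1\}$, $U=V\setminus\{v_1\}$. While $Q\neq\emptyset$: pick a vertex $v$ uniformly at random from $Q$; let $N$ be the set of neighbors of $v$ in $U$; set $P\leftarrow P\cup\{v\}$, $Q\leftarrow(Q\setminus\{v\})\cup N$, $U\leftarrow U\setminus N$. $P_t,Q_t,U_t$ are the sets after $t$ steps, $|P_t|=t$, and $\pi=t/n$. *)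

theory Defs
  imports
    "HOL-Probability.Probability_Mass_Function"
    "HOL-Computational_Algebra.Polynomial"
    "Jordan_Normal_Form.Char_Poly"
    "Graph_Theory.Digraph"
begin

text \<open>
  A finite simple undirected graph is the locale \<^locale>\<open>graph\<close> of the AFP entry Graph_Theory:
  a finite, loop-free, symmetric digraph without parallel arcs.
\<close>

definition regular_graph :: "('a, 'b) pre_digraph \<Rightarrow> nat \<Rightarrow> bool" where
  "regular_graph G d \<longleftrightarrow> graph G \<and> (\<forall>v\<in>verts G. out_degree G v = d)"

definition adjacency_matrix :: "('a, 'b) pre_digraph \<Rightarrow> 'a list \<Rightarrow> real mat" where
  "adjacency_matrix G vs =
     mat (length vs) (length vs) (\<lambda>(i, j). of_bool (vs ! i \<rightarrow>\<^bsub>G\<^esub> vs ! j))"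

text \<open>
  The eigenvalues with multiplicity, in descending order. Different enumerations of the vertices
  give permutation-similar matrices, so the choice of enumeration is immaterial. As the adjacency
  matrix of a graph is real symmetric, its characteristic polynomial splits over the reals, and
  the list has length \<open>n\<close>; the \<open>i\<close>-th eigenvalue of the usual numbering is at position \<open>i - 1\<close>.
\<close>

definition graph_eigenvalues :: "('a, 'b) pre_digraph \<Rightarrow> real list" where
  "graph_eigenvalues G =
     (let vs = (SOME vs. distinct vs \<and> set vs = verts G)
      in rev (sorted_list_of_multiset (proots (char_poly (adjacency_matrix G vs)))))"

definition graph_lambda :: "('a, 'b) pre_digraph \<Rightarrow> real" where
  "graph_lambda G =
     max \<bar>graph_eigenvalues G ! 1\<bar> \<bar>graph_eigenvalues G ! (card (verts G) - 1)\<bar>"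

text \<open>States of the Random Growth process are triples \<open>(P, Q, U)\<close>.\<close>

type_synonym 'a growth_state = "'a set \<times> 'a set \<times> 'a set"

text \<open>The process has stopped once the queue is empty; the state then no longer changes.\<close>

definition growth_step :: "('a, 'b) pre_digraph \<Rightarrow> 'a growth_state \<Rightarrow> 'a growth_state pmf" where
  "growth_step G = (\<lambda>(P, Q, U).
     if Q = {} then return_pmf (P, Q, U)
     else map_pmf
       (\<lambda>v. let N = {w \<in> U. v \<rightarrow>\<^bsub>G\<^esub> w} in (P \<union> {v}, (Q - {v}) \<union> N, U - N))
       (pmf_of_set Q))"

primrec random_growth :: "('a, 'b) pre_digraph \<Rightarrow> 'a \<Rightarrow> nat \<Rightarrow> 'a growth_state pmf" where
  "random_growth G v1 0 = return_pmf ({}, {v1}, verts G - {v1})"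
| "random_growth G v1 (Suc t) = bind_pmf (random_growth G v1 t) (growth_step G)"

end

(*
A maximiser of the Rayleigh quotient on the zero-sum functions is an eigenfunction, and the maximum is
at most the second eigenvalue. Applied to the centred indicator function of U this bounds the
number of edges leaving U from below by (d - lambda) |U| |V - U| / n.

Processed vertices have no unvisited neighbours, so all edges leaving U end in Q, and a uniformly
random vertex of Q has in expectation at least (d - lambda) |U| / n * (1 + t / |Q|) neighbours in U.
A queue vertex has a processed neighbour, so each step adds at most d - 1 vertices; hence
|Q| <= (d - 2) t + 2 <= (d - 1) t for t >= 2, and E|U| decays by the factor
1 - (d - lambda) / n * (1 + 1 / (d - 1)) per step. The first two steps are computed directly; they
use lambda >= 1, which follows from testing the smallest eigenvalue on the difference of the
indicator functions of two adjacent vertices.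
*)
theory Submission
  imports Defs
begin

lemma rayleigh_maximizer:
  fixes a :: "'i \<Rightarrow> 'i \<Rightarrow> real" and w f0 :: "'i \<Rightarrow> real"
  assumes fin: "finite I"
    and sym: "\<And>i j. i \<in> I \<Longrightarrow> j \<in> I \<Longrightarrow> a i j = a j i"
    and w: "\<And>i. i \<in> I \<Longrightarrow> (\<Sum>j\<in>I. a i j * w j) = r * w i"
    and f0: "(\<Sum>i\<in>I. w i * f0 i) = 0" "\<exists>i\<in>I. f0 i \<noteq> 0"
  obtains \<mu> f where "\<exists>i\<in>I. f i \<noteq> 0" "(\<Sum>i\<in>I. w i * f i) = 0"
    "\<And>i. i \<in> I \<Longrightarrow> (\<Sum>j\<in>I. a i j * f j) = \<mu> * f i"
    "\<And>g. (\<Sum>i\<in>I. w i * g i) = 0 \<Longrightarrow>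
       (\<Sum>i\<in>I. \<Sum>j\<in>I. a i j * g i * g j) \<le> \<mu> * (\<Sum>i\<in>I. (g i)\<^sup>2)"
proof -
  define N where "N g = (\<Sum>i\<in>I. (g i)\<^sup>2)" for g :: "'i \<Rightarrow> real"
  define Q where "Q g = (\<Sum>i\<in>I. \<Sum>j\<in>I. a i j * g i * g j)" for g :: "'i \<Rightarrow> real"
  define L where "L g = (\<Sum>i\<in>I. w i * g i)" for g :: "'i \<Rightarrow> real"
  define B where "B = (\<Pi>\<^sub>E i\<in>UNIV. if i \<in> I then {-1..1::real} else {0})"
  define S where "S = B \<inter> {g. N g = 1 \<and> L g = 0}"
  have "compactin (product_topology (\<lambda>i. euclidean) UNIV) B"
    unfolding B_def by (subst compactin_PiE) auto
  then have cB: "compact B"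
    by (simp add: euclidean_product_topology)
  have cont [continuous_intros]: "continuous_on A (\<lambda>g::'i \<Rightarrow> real. g i)" for A i
    by (rule continuous_on_subset[OF continuous_on_product_coordinates]) simp
  have cN: "continuous_on UNIV N" and cQ: "continuous_on UNIV Q" and cL: "continuous_on UNIV L"
    unfolding N_def Q_def L_def by (intro continuous_intros)+
  have "closed {g. N g = 1 \<and> L g = 0}"
    by (intro closed_Collect_conj closed_Collect_eq cN cL continuous_intros)
  with cB have cS: "compact S"
    unfolding S_def by (rule compact_Int_closed)
  have N_scale: "N (\<lambda>i. if i \<in> I then c * g i else 0) = c\<^sup>2 * N g" for c g
    by (simp add: N_def sum_distrib_left power_mult_distrib)
  have L_scale: "L (\<lambda>i. if i \<in> I then c * g i else 0) = c * L g" for c g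
    by (simp add: L_def sum_distrib_left mult_ac)
  have Q_scale: "Q (\<lambda>i. if i \<in> I then c * g i else 0) = c\<^sup>2 * Q g" for c g
    by (simp add: Q_def sum_distrib_left power2_eq_square mult_ac)
  have N_pos: "N g > 0" if "\<exists>i\<in>I. g i \<noteq> 0" for g
    using that fin unfolding N_def by (auto intro!: sum_pos2)
  define nm where "nm g = (\<lambda>i. if i \<in> I then inverse (sqrt (N g)) * g i else 0)" for g
  have nm_S: "nm g \<in> S" if "L g = 0" "\<exists>i\<in>I. g i \<noteq> 0" for g
  proof -
    have sq: "N (nm g) = 1"
      using N_pos[OF that(2)] unfolding nm_def N_scale by (simp add: power_inverse)
    have "\<bar>nm g i\<bar> \<le> 1" if "i \<in> I" for i
    proof -
      have "(nm g i)\<^sup>2 \<le> N (nm g)"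
        unfolding N_def using that fin by (intro member_le_sum) auto
      then show ?thesis using sq by (simp add: abs_square_le_1)
    qed
    then have "nm g \<in> B"
      by (auto simp: B_def abs_le_iff) (auto simp: nm_def)
    moreover have "L (nm g) = 0" unfolding nm_def L_scale that by simp
    ultimately show ?thesis using sq by (simp add: S_def)
  qed
  have "S \<noteq> {}" using nm_S[of f0] f0 by (auto simp: L_def)
  with cS obtain f where f: "f \<in> S" and fmax: "\<And>g. g \<in> S \<Longrightarrow> Q g \<le> Q f"
    using continuous_attains_sup[of S Q] continuous_on_subset[OF cQ] by blast
  define \<mu> where "\<mu> = Q f"
  have fN: "N f = 1" and fL: "L f = 0" using f by (auto simp: S_def)
  have max: "Q g \<le> \<mu> * N g" if "L g = 0" for g
  proof (cases "\<exists>i\<in>I. g i \<noteq> 0")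
    case True
    note Ng = N_pos[OF True]
    have "Q (nm g) \<le> \<mu>" using fmax nm_S[OF that True] by (simp add: \<mu>_def)
    moreover have "Q (nm g) = Q g / N g"
      using Ng unfolding nm_def Q_scale by (simp add: power_inverse field_simps)
    ultimately show ?thesis using Ng by (simp add: field_simps)
  next
    case False
    then have "Q g = 0" "N g = 0" by (auto simp: Q_def N_def)
    then show ?thesis by simp
  qed
  define h where "h i = (\<Sum>j\<in>I. a i j * f j) - \<mu> * f i" for i
  define P where "P = (\<Sum>i\<in>I. h i * f i)"
  have "(\<Sum>i\<in>I. w i * (\<Sum>j\<in>I. a i j * f j)) = (\<Sum>i\<in>I. \<Sum>j\<in>I. f i * (a i j * w j))"
    by (simp add: sum_distrib_left, subst sum.swap) (auto intro!: sum.cong simp: sym mult_ac)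
  also have "\<dots> = (\<Sum>i\<in>I. f i * (r * w i))"
    by (intro sum.cong refl) (simp add: w sum_distrib_left[symmetric])
  also have "\<dots> = r * L f" by (simp add: L_def sum_distrib_left mult_ac)
  finally have Lh: "L h = 0"
    using fL by (simp add: L_def h_def right_diff_distrib sum_subtractf sum_distrib_left[symmetric] mult.left_commute[of _ \<mu>])
  have expand: "Q (\<lambda>i. f i + s * h i) - \<mu> * N (\<lambda>i. f i + s * h i)
      = 2 * s * N h + s\<^sup>2 * (Q h - \<mu> * N h)" for s
  proof -
    have "Q (\<lambda>i. f i + s * h i) = Q f + s * (\<Sum>i\<in>I. \<Sum>j\<in>I. a i j * h i * f j)
        + s * (\<Sum>i\<in>I. \<Sum>j\<in>I. a i j * f i * h j) + s\<^sup>2 * Q h"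
      unfolding Q_def by (simp add: algebra_simps power2_eq_square sum.distrib sum_distrib_left)
    moreover have "(\<Sum>i\<in>I. \<Sum>j\<in>I. a i j * f i * h j) = (\<Sum>i\<in>I. \<Sum>j\<in>I. a i j * h i * f j)"
      by (subst sum.swap) (auto intro!: sum.cong simp: sym mult_ac)
    moreover have "(\<Sum>i\<in>I. \<Sum>j\<in>I. a i j * h i * f j) = (\<Sum>i\<in>I. h i * (h i + \<mu> * f i))"
    proof (intro sum.cong refl)
      fix i
      have "(\<Sum>j\<in>I. a i j * h i * f j) = h i * (\<Sum>j\<in>I. a i j * f j)"
        by (simp add: sum_distrib_left mult_ac)
      then show "(\<Sum>j\<in>I. a i j * h i * f j) = h i * (h i + \<mu> * f i)"
        by (simp add: h_def)
    qed
    moreover have "\<dots> = N h + \<mu> * P"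
      by (simp add: N_def P_def algebra_simps power2_eq_square sum.distrib sum_distrib_left)
    moreover have "N (\<lambda>i. f i + s * h i) = N f + 2 * s * P + s\<^sup>2 * N h"
      by (simp add: N_def P_def algebra_simps power2_eq_square sum.distrib sum_distrib_left)
    ultimately show ?thesis using fN by (simp add: \<mu>_def algebra_simps)
  qed
  \<comment> \<open>Otherwise a small step from \<open>f\<close> in direction \<open>h\<close> would increase the Rayleigh quotient.\<close>
  have "N h = 0"
  proof (rule ccontr)
    define K where "K = Q h - \<mu> * N h"
    assume "N h \<noteq> 0"
    moreover have "N h \<ge> 0" by (simp add: N_def sum_nonneg)
    ultimately have pos: "N h > 0" by simp
    have K: "K \<le> 0" using max[OF Lh] by (simp add: K_def)
    define s where "s = N h / (1 - K)"
    have s: "s > 0" "s * (1 - K) = N h" using pos K by (auto simp: s_def field_simps)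
    have "L (\<lambda>i. f i + s * h i) = L f + s * L h"
      by (simp add: L_def algebra_simps sum.distrib sum_distrib_left)
    then have "2 * s * N h + s\<^sup>2 * K \<le> 0"
      using max[of "\<lambda>i. f i + s * h i"] expand[of s] fL Lh by (simp add: K_def)
    moreover have "2 * s * N h + s\<^sup>2 * K = s * (N h + s)"
      unfolding s(2)[symmetric] by (simp add: power2_eq_square algebra_simps)
    moreover have "s * (N h + s) > 0" using s pos by simp
    ultimately show False by simp
  qed
  then have h0: "h i = 0" if "i \<in> I" for i
    using that fin by (simp add: N_def sum_nonneg_eq_0_iff)
  have "\<exists>i\<in>I. f i \<noteq> 0"
  proof (rule ccontr)
    assume "\<not> ?thesis"
    then have "N f = 0" by (simp add: N_def)
    with fN show False by simp
  qed
  moreover have "(\<Sum>j\<in>I. a i j * f j) = \<mu> * f i" if "i \<in> I" for i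
    using h0[OF that] by (simp add: h_def)
  ultimately show ?thesis
    using fL max by (intro that[of f \<mu>]) (auto simp: L_def Q_def N_def)
qed

lemma det_multrow_first:
  assumes "A \<in> carrier_mat n n" "n > 0"
  shows "det (multrow 0 c A) = c * det A"
  using det_multrow[of 0 n A c] assms by simp

text \<open>
  Needed when \<open>\<mu> = d\<close>, where it says that \<open>d\<close> is a multiple root. In the characteristic matrix \<open>C\<close>,
  replacing the first row by the sum of all rows makes it the constant row \<open>X - d\<close>; dividing it out
  leaves a matrix \<open>M\<close> which at \<open>X = \<mu>\<close> annihilates the zero-sum eigenvector.
\<close>
lemma char_poly_dvd_of_zero_sum_eigenvector:
  fixes a :: "nat \<Rightarrow> nat \<Rightarrow> real"
  assumes col: "\<And>j. j < n \<Longrightarrow> (\<Sum>i<n. a i j) = d"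
    and f: "\<exists>i<n. f i \<noteq> 0" "(\<Sum>i<n. f i) = 0" "\<And>i. i < n \<Longrightarrow> (\<Sum>j<n. a i j * f j) = \<mu> * f i"
  shows "[:- d, 1:] * [:- \<mu>, 1:] dvd char_poly (mat n n (\<lambda>(i, j). a i j))"
proof -
  define A where "A = mat n n (\<lambda>(i, j). a i j)"
  define C where "C = char_poly_matrix A"
  define M where "M = mat n n (\<lambda>(i, j). if i = 0 then 1 else C $$ (i, j))"
  define E where "E = mat n n (\<lambda>(i, j). if i = 0 \<or> i = j then 1 else 0 :: real poly)"
  have n: "n > 0" using f(1) by auto
  have A: "A \<in> carrier_mat n n" by (simp add: A_def)
  have C: "C \<in> carrier_mat n n" using A by (simp add: C_def)
  have M: "M \<in> carrier_mat n n" and E: "E \<in> carrier_mat n n" by (simp_all add: M_def E_def)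
  have C_idx: "C $$ (i, j) = (if i = j then [:0, 1:] else 0) + [:- a i j:]" if "i < n" "j < n" for i j
    using that by (auto simp: C_def char_poly_matrix_def A_def)
  have const_sum: "(\<Sum>i\<in>S. [:- g i:]) = [:- (\<Sum>i\<in>S. g i):]" for g :: "nat \<Rightarrow> real" and S
    by (induction S rule: infinite_finite_induct) auto
  have C_col: "(\<Sum>i<n. C $$ (i, j)) = [:- d, 1:]" if "j < n" for j
    using that by (simp add: C_idx sum.distrib const_sum col)
  have EC: "E * C = multrow 0 [:- d, 1:] M"
  proof (rule eq_matI)
    fix i j
    assume "i < dim_row (multrow 0 [:- d, 1:] M)" "j < dim_col (multrow 0 [:- d, 1:] M)"
    then have ij: "i < n" "j < n" using M by auto
    have "(E * C) $$ (i, j) = (\<Sum>k<n. (if i = 0 \<or> i = k then 1 else 0) * C $$ (k, j))"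
      using ij E C by (simp add: scalar_prod_def E_def lessThan_atLeast0)
    also have "\<dots> = (if i = 0 then [:- d, 1:] else C $$ (i, j))"
      using ij by (simp add: C_col if_distrib[of "\<lambda>x. x * _"] cong: if_cong)
    finally show "(E * C) $$ (i, j) = multrow 0 [:- d, 1:] M $$ (i, j)"
      using ij M by (simp add: M_def)
  qed (use E C M in auto)
  have "det E = 1"
  proof -
    have "upper_triangular E" by (auto simp: upper_triangular_def E_def)
    moreover have "diag_mat E = replicate n 1"
      by (rule nth_equalityI) (auto simp: diag_mat_def E_def)
    ultimately show ?thesis by (simp add: det_upper_triangular[OF _ E])
  qed
  then have "char_poly A = det (E * C)"
    by (simp add: Determinant.det_mult[OF E C] char_poly_def C_def[symmetric])
  then have cp: "char_poly A = [:- d, 1:] * det M"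
    by (simp only: EC det_multrow_first[OF M n])
  define M' where "M' = mat n n (\<lambda>(i, j). poly (M $$ (i, j)) \<mu>)"
  have M': "M' \<in> carrier_mat n n" by (simp add: M'_def)
  define v where "v = vec n f"
  have "M' *\<^sub>v v = 0\<^sub>v n"
  proof (rule eq_vecI)
    fix i assume "i < dim_vec (0\<^sub>v n :: real vec)"
    then have i: "i < n" by simp
    have "(M' *\<^sub>v v) $ i = (\<Sum>j<n. poly (M $$ (i, j)) \<mu> * f j)"
      using i by (simp add: M'_def v_def scalar_prod_def lessThan_atLeast0)
    also have "\<dots> = 0"
    proof (cases "i = 0")
      case True
      then show ?thesis using n f(2) by (simp add: M_def)
    next
      case False
      have "(\<Sum>j<n. poly (M $$ (i, j)) \<mu> * f j) = (\<Sum>j<n. (if i = j then \<mu> * f j else 0) - a i j * f j)"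
        using i False by (intro sum.cong) (auto simp: M_def C_idx algebra_simps)
      also have "\<dots> = 0" using i by (simp add: sum_subtractf f(3))
      finally show ?thesis .
    qed
    finally show "(M' *\<^sub>v v) $ i = 0\<^sub>v n $ i" using i by simp
  qed (simp add: M'_def)
  moreover have "v \<noteq> 0\<^sub>v n" using f(1) by (auto simp: v_def vec_eq_iff)
  moreover have "v \<in> carrier_vec n" by (simp add: v_def)
  ultimately have "det M' = 0" using det_0_iff_vec_prod_zero[OF M'] by blast
  then have "poly (det M) \<mu> = 0"
    using poly_det_cong[OF M' M, of \<mu>] by (simp add: M'_def)
  then have "[:- \<mu>, 1:] dvd det M" by (simp add: poly_eq_0_iff_dvd)
  then show ?thesis unfolding A_def[symmetric] cp by (rule mult_dvd_mono[OF dvd_refl])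
qed

lemma real_symmetric_eigenvalue_real:
  fixes A :: "real mat"
  assumes A: "A \<in> carrier_mat n n"
    and sym: "\<And>i j. i < n \<Longrightarrow> j < n \<Longrightarrow> A $$ (i, j) = A $$ (j, i)"
    and ev: "eigenvalue (map_mat complex_of_real A) z"
  shows "z = complex_of_real (Re z)"
proof -
  let ?A = "map_mat complex_of_real A"
  obtain v where v: "v \<in> carrier_vec n" "v \<noteq> 0\<^sub>v n" "?A *\<^sub>v v = z \<cdot>\<^sub>v v"
    using ev A unfolding eigenvalue_def eigenvector_def by auto
  define x where "x i = v $ i" for i
  have Ax: "(\<Sum>j<n. of_real (A $$ (i, j)) * x j) = z * x i" if "i < n" for i
    using arg_cong[OF v(3), of "\<lambda>u. u $ i"] that A v(1)
    by (simp add: scalar_prod_def x_def lessThan_atLeast0)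
  define q where "q = (\<Sum>i<n. \<Sum>j<n. cnj (x i) * (of_real (A $$ (i, j)) * x j))"
  define N where "N = (\<Sum>i<n. (cmod (x i))\<^sup>2)"
  have "of_real N = (\<Sum>i<n. x i * cnj (x i))"
    unfolding N_def of_real_sum complex_norm_square ..
  then have "q = z * of_real N"
    by (simp add: q_def sum_distrib_left[symmetric] Ax)
       (simp add: sum_distrib_left mult_ac)
  moreover have "cnj q = q"
    unfolding q_def by (simp, subst sum.swap) (auto intro!: sum.cong simp: sym mult_ac)
  ultimately have "cnj z * of_real N = z * of_real N" by simp
  moreover have "N > 0"
  proof -
    obtain i where i: "i < n" "x i \<noteq> 0"
      using v(1,2) unfolding x_def by (metis carrier_vecD eq_vecI index_zero_vec(1,2))
    then show ?thesis unfolding N_def by (intro sum_pos2[of _ i]) auto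
  qed
  ultimately have "cnj z = z" by simp
  then show ?thesis by (simp add: complex_eq_iff)
qed

lemma size_proots_char_poly_real_symmetric:
  fixes A :: "real mat"
  assumes A: "A \<in> carrier_mat n n"
    and sym: "\<And>i j. i < n \<Longrightarrow> j < n \<Longrightarrow> A $$ (i, j) = A $$ (j, i)"
  shows "size (proots (char_poly A)) = n"
proof -
  interpret map_poly_of_real: map_poly_comm_ring_hom complex_of_real ..
  let ?A = "map_mat complex_of_real A"
  have cA: "?A \<in> carrier_mat n n" using A by simp
  obtain zs where zs: "char_poly ?A = (\<Prod>z\<leftarrow>zs. [:- z, 1:])" "length zs = n"
    using char_poly_factorized[OF cA] by blast
  have real: "z = of_real (Re z)" if "z \<in> set zs" for z
  proof -
    have "poly (char_poly ?A) z = 0"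
      using that unfolding zs(1) poly_prod_list by (auto simp: prod_list_zero_iff)
    then show ?thesis
      using real_symmetric_eigenvalue_real[OF A sym] eigenvalue_root_char_poly[OF cA] by blast
  qed
  have "map_poly complex_of_real (char_poly A) = (\<Prod>z\<leftarrow>zs. [:- z, 1:])"
    using of_real_hom.char_poly_hom[OF A] zs(1) by metis
  also have "\<dots> = (\<Prod>z\<leftarrow>zs. map_poly complex_of_real [:- Re z, 1:])"
    using real by (intro arg_cong[of _ _ prod_list] map_cong refl) (auto simp: hom_distribs)
  also have "\<dots> = map_poly complex_of_real (\<Prod>z\<leftarrow>zs. [:- Re z, 1:])"
    by (simp add: map_poly_of_real.hom_prod_list o_def)
  finally have "char_poly A = (\<Prod>z\<leftarrow>zs. [:- Re z, 1:])"
    by (simp add: poly_eq_iff coeff_map_poly)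
  moreover have "proots (\<Prod>z\<leftarrow>zs. [:- Re z, 1:]) = mset (map Re zs)"
  proof (induction zs)
    case (Cons z zs)
    have "(\<Prod>z\<leftarrow>zs. [:- Re z, 1:]) \<noteq> 0" by (subst prod_list_zero_iff) auto
    then show ?case using Cons by (simp add: proots_mult del: mult_pCons_left)
  qed simp
  ultimately show ?thesis using zs(2) by simp
qed

lemma sorted_wrt_nth_one_ge:
  assumes "sorted_wrt (\<ge>) xs" "{#x, y#} \<subseteq># mset xs"
  shows "xs ! 1 \<ge> min x (y :: 'x :: linorder)"
proof -
  have "size {#x, y#} \<le> size (mset xs)" using assms(2) by (rule size_mset_mono)
  then obtain u v ys where xs: "xs = u # v # ys"
    by (cases xs rule: remdups_adj.cases) auto
  show ?thesis
  proof (rule ccontr)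
    assume "\<not> ?thesis"
    then have "v < x" "v < y" by (simp_all add: xs not_le)
    then have "x \<notin> set (v # ys)" "y \<notin> set (v # ys)" using assms(1) by (auto simp: xs)
    moreover from this have "x = u" "y = u"
      using mset_subset_eqD[OF assms(2), of x] mset_subset_eqD[OF assms(2), of y] by (auto simp: xs)
    ultimately show False using assms(2) by (auto simp: xs)
  qed
qed

lemma sorted_wrt_last_le:
  assumes "sorted_wrt (\<ge>) xs" "x \<in> set xs"
  shows "xs ! (length xs - 1) \<le> (x :: 'x :: linorder)"
proof -
  obtain i where i: "i < length xs" "xs ! i = x" using assms(2) by (auto simp: in_set_conv_nth)
  then show ?thesis
    using sorted_wrt_nth_less[OF assms(1), of i "length xs - 1"]
    by (cases "i = length xs - 1") auto
qed

context
  fixes G :: "('a, 'b) pre_digraph" and d :: nat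
  assumes reg: "regular_graph G d"
begin

interpretation graph G
  using reg by (simp add: regular_graph_def)

lemma adj_sym: "u \<rightarrow>\<^bsub>G\<^esub> v \<longleftrightarrow> v \<rightarrow>\<^bsub>G\<^esub> u"
  using arcs_ends_symmetric[OF sym_arcs] by blast

lemma adj_verts: "u \<rightarrow>\<^bsub>G\<^esub> v \<Longrightarrow> u \<in> verts G \<and> v \<in> verts G"
  by (auto simp: arcs_ends_conv)

lemma card_neighbours:
  assumes "v \<in> verts G"
  shows "card {w. v \<rightarrow>\<^bsub>G\<^esub> w} = d"
proof -
  have "{w. v \<rightarrow>\<^bsub>G\<^esub> w} = head G ` out_arcs G v"
    by (auto simp: arcs_ends_conv out_arcs_def)
  moreover have "inj_on (head G) (out_arcs G v)"
    by (auto intro!: inj_onI no_multi_arcs simp: arc_to_ends_def)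
  moreover have "card (out_arcs G v) = d"
    using reg assms by (simp add: regular_graph_def out_degree_def)
  ultimately show ?thesis by (simp add: card_image)
qed

lemma finite_neighbours: "finite {w. v \<rightarrow>\<^bsub>G\<^esub> w}"
  by (rule finite_subset[OF _ finite_verts]) (auto dest: adj_verts)

lemma sum_adj:
  assumes "v \<in> verts G"
  shows "(\<Sum>w\<in>verts G. of_bool (v \<rightarrow>\<^bsub>G\<^esub> w)) = real d"
proof -
  have "verts G \<inter> {w. v \<rightarrow>\<^bsub>G\<^esub> w} = {w. v \<rightarrow>\<^bsub>G\<^esub> w}" by (auto dest: adj_verts)
  then show ?thesis using card_neighbours[OF assms] by simp
qed

lemma graph_eigenvalues_enum:
  obtains vs where "distinct vs" "set vs = verts G"
    "graph_eigenvalues G = rev (sorted_list_of_multiset (proots (char_poly (adjacency_matrix G vs))))"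
proof -
  define vs where "vs = (SOME vs. distinct vs \<and> set vs = verts G)"
  have "distinct vs \<and> set vs = verts G"
    unfolding vs_def by (rule someI_ex) (use finite_distinct_list[OF finite_verts] in blast)
  then show ?thesis by (intro that[of vs]) (simp_all add: graph_eigenvalues_def vs_def)
qed

lemma sum_verts_nth:
  assumes "distinct vs" "set vs = verts G"
  shows "(\<Sum>v\<in>verts G. F v) = (\<Sum>i<card (verts G). F (vs ! i))"
  using assms sum.reindex_bij_betw[OF bij_betw_nth[OF assms(1) refl assms(2)[symmetric]]]
  by (metis distinct_card)

lemma adjacency_matrix_carrier:
  assumes "distinct vs" "set vs = verts G"
  shows "adjacency_matrix G vs \<in> carrier_mat (card (verts G)) (card (verts G))"
  using assms by (simp add: adjacency_matrix_def distinct_card[symmetric])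

lemma char_poly_adjacency_matrix_nonzero:
  assumes "distinct vs" "set vs = verts G"
  shows "char_poly (adjacency_matrix G vs) \<noteq> 0"
  using degree_monic_char_poly[OF adjacency_matrix_carrier[OF assms]] by auto

lemma length_graph_eigenvalues: "length (graph_eigenvalues G) = card (verts G)"
proof -
  obtain vs where vs: "distinct vs" "set vs = verts G"
    "graph_eigenvalues G = rev (sorted_list_of_multiset (proots (char_poly (adjacency_matrix G vs))))"
    by (rule graph_eigenvalues_enum)
  have len: "length vs = card (verts G)" using vs(1,2) distinct_card by metis
  have "size (proots (char_poly (adjacency_matrix G vs))) = card (verts G)"
    by (rule size_proots_char_poly_real_symmetric[OF adjacency_matrix_carrier[OF vs(1,2)]])
       (simp add: adjacency_matrix_def len adj_sym)
  then show ?thesis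
    unfolding vs(3) by (metis length_rev size_mset mset_sorted_list_of_multiset)
qed

lemma graph_eigenvalues_sorted: "sorted_wrt (\<ge>) (graph_eigenvalues G)"
  by (simp add: graph_eigenvalues_def Let_def sorted_wrt_rev)

lemma eigenfunction_in_graph_eigenvalues:
  assumes f: "\<exists>v\<in>verts G. f v \<noteq> 0"
    and ev: "\<And>u. u \<in> verts G \<Longrightarrow> (\<Sum>v\<in>verts G. of_bool (u \<rightarrow>\<^bsub>G\<^esub> v) * f v) = \<mu> * f u"
  shows "\<mu> \<in> set (graph_eigenvalues G)"
proof -
  obtain vs where vs: "distinct vs" "set vs = verts G"
    "graph_eigenvalues G = rev (sorted_list_of_multiset (proots (char_poly (adjacency_matrix G vs))))"
    by (rule graph_eigenvalues_enum)
  define A where "A = adjacency_matrix G vs"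
  define n where "n = card (verts G)"
  have A: "A \<in> carrier_mat n n"
    unfolding A_def n_def by (rule adjacency_matrix_carrier[OF vs(1,2)])
  have len: "length vs = n" unfolding n_def using vs(1,2) distinct_card by metis
  define x where "x = vec n (\<lambda>i. f (vs ! i))"
  have "A *\<^sub>v x = \<mu> \<cdot>\<^sub>v x"
  proof (rule eq_vecI)
    fix i assume "i < dim_vec (\<mu> \<cdot>\<^sub>v x)"
    then have i: "i < n" by (simp add: x_def)
    then have "vs ! i \<in> verts G" using vs(2) len nth_mem by blast
    from ev[OF this] show "(A *\<^sub>v x) $ i = (\<mu> \<cdot>\<^sub>v x) $ i"
      using i A by (simp add: sum_verts_nth[OF vs(1,2)] x_def scalar_prod_def A_def
          adjacency_matrix_def len n_def[symmetric] lessThan_atLeast0)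
  qed (use A in \<open>simp add: x_def\<close>)
  moreover have "x \<noteq> 0\<^sub>v n"
  proof -
    obtain i where "i < n" "f (vs ! i) \<noteq> 0"
      using f unfolding vs(2)[symmetric] len[symmetric] by (auto simp: in_set_conv_nth)
    then show ?thesis by (auto simp: x_def vec_eq_iff)
  qed
  ultimately have "eigenvalue A \<mu>"
    using A unfolding eigenvalue_def eigenvector_def by (intro exI[of _ x]) (simp add: x_def)
  then show ?thesis
    using eigenvalue_root_char_poly[OF A] char_poly_adjacency_matrix_nonzero[OF vs(1,2)]
    by (simp add: vs(3) A_def)
qed

lemma zero_sum_eigenfunction_le_second_eigenvalue:
  assumes f: "\<exists>v\<in>verts G. f v \<noteq> 0" "(\<Sum>v\<in>verts G. f v) = 0"
    and ev: "\<And>u. u \<in> verts G \<Longrightarrow> (\<Sum>v\<in>verts G. of_bool (u \<rightarrow>\<^bsub>G\<^esub> v) * f v) = \<mu> * f u"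
  shows "min (real d) \<mu> \<le> graph_eigenvalues G ! 1"
proof -
  obtain vs where vs: "distinct vs" "set vs = verts G"
    "graph_eigenvalues G = rev (sorted_list_of_multiset (proots (char_poly (adjacency_matrix G vs))))"
    by (rule graph_eigenvalues_enum)
  define n where "n = card (verts G)"
  define p where "p = char_poly (adjacency_matrix G vs)"
  have len: "length vs = n" unfolding n_def using vs(1,2) distinct_card by metis
  have vsV: "vs ! i \<in> verts G" if "i < n" for i using that vs(2) len nth_mem by blast
  note sum_nth = sum_verts_nth[OF vs(1,2), folded n_def]
  have "[:- real d, 1:] * [:- \<mu>, 1:] dvd char_poly (mat n n (\<lambda>(i, j). of_bool (vs ! i \<rightarrow>\<^bsub>G\<^esub> vs ! j)))"
  proof (rule char_poly_dvd_of_zero_sum_eigenvector)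
    show "(\<Sum>i<n. of_bool (vs ! i \<rightarrow>\<^bsub>G\<^esub> vs ! j)) = real d" if "j < n" for j
      using sum_adj[OF vsV[OF that]] by (subst adj_sym) (simp only: sum_nth)
    show "\<exists>i<n. f (vs ! i) \<noteq> 0"
      using f(1) unfolding vs(2)[symmetric] len[symmetric] by (auto simp: in_set_conv_nth)
    show "(\<Sum>i<n. f (vs ! i)) = 0" using f(2) by (simp add: sum_nth)
    show "(\<Sum>j<n. of_bool (vs ! i \<rightarrow>\<^bsub>G\<^esub> vs ! j) * f (vs ! j)) = \<mu> * f (vs ! i)" if "i < n" for i
      using ev[OF vsV[OF that]] by (simp only: sum_nth)
  qed
  then obtain q where q: "p = [:- real d, 1:] * [:- \<mu>, 1:] * q"
    by (auto simp: p_def adjacency_matrix_def len)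
  have "p \<noteq> 0" unfolding p_def by (rule char_poly_adjacency_matrix_nonzero[OF vs(1,2)])
  then have "q \<noteq> 0" by (auto simp: q)
  then have "proots p = {#real d, \<mu>#} + proots q"
    unfolding q by (simp add: proots_mult del: mult_pCons_left mult_pCons_right)
  then have "{#real d, \<mu>#} \<subseteq># mset (graph_eigenvalues G)"
    by (simp add: vs(3) p_def)
  then show ?thesis by (rule sorted_wrt_nth_one_ge[OF graph_eigenvalues_sorted])
qed

lemma rayleigh_le_lambda:
  assumes lam: "graph_lambda G < real d" and card: "card (verts G) \<ge> 2"
    and g: "(\<Sum>v\<in>verts G. g v) = 0"
  shows "(\<Sum>u\<in>verts G. \<Sum>v\<in>verts G. of_bool (u \<rightarrow>\<^bsub>G\<^esub> v) * g u * g v)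
           \<le> graph_lambda G * (\<Sum>v\<in>verts G. (g v)\<^sup>2)"
proof -
  obtain x y where xy: "x \<in> verts G" "y \<in> verts G" "x \<noteq> y"
    using card by (metis card_le_Suc0_iff_eq finite_verts not_less_eq_eq numeral_2_eq_2)
  define f0 where "f0 v = of_bool (v = x) - (of_bool (v = y) :: real)" for v
  define a where "a u v = (of_bool (u \<rightarrow>\<^bsub>G\<^esub> v) :: real)" for u v
  have sym: "a u v = a v u" for u v by (simp add: a_def adj_sym)
  have row: "(\<Sum>v\<in>verts G. a u v * 1) = real d * 1" if "u \<in> verts G" for u
    using sum_adj[OF that] by (simp add: a_def)
  have zero: "(\<Sum>v\<in>verts G. 1 * f0 v) = 0"
    using xy by (simp add: f0_def sum_subtractf of_bool_def)
  have nonzero: "\<exists>v\<in>verts G. f0 v \<noteq> 0"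
    using xy by (intro bexI[of _ x]) (auto simp: f0_def)
  obtain \<mu> f where f: "\<exists>v\<in>verts G. f v \<noteq> 0" "(\<Sum>v\<in>verts G. 1 * f v) = 0"
    "\<And>u. u \<in> verts G \<Longrightarrow> (\<Sum>v\<in>verts G. a u v * f v) = \<mu> * f u"
    "\<And>g. (\<Sum>v\<in>verts G. 1 * g v) = 0 \<Longrightarrow>
       (\<Sum>u\<in>verts G. \<Sum>v\<in>verts G. a u v * g u * g v) \<le> \<mu> * (\<Sum>v\<in>verts G. (g v)\<^sup>2)"
    by (rule rayleigh_maximizer[of "verts G" a "\<lambda>_. 1" "real d" f0, OF finite_verts sym row zero nonzero],
        assumption, rule that)
  have "min (real d) \<mu> \<le> graph_eigenvalues G ! 1"
    by (rule zero_sum_eigenfunction_le_second_eigenvalue[OF f(1)]) (use f(2,3) in \<open>simp_all add: a_def\<close>)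
  also have "\<dots> \<le> graph_lambda G" by (simp add: graph_lambda_def)
  finally have "\<mu> \<le> graph_lambda G" using lam by linarith
  then have "\<mu> * (\<Sum>v\<in>verts G. (g v)\<^sup>2) \<le> graph_lambda G * (\<Sum>v\<in>verts G. (g v)\<^sup>2)"
    by (intro mult_right_mono sum_nonneg) auto
  then show ?thesis using f(4)[of g] g by (simp add: a_def)
qed

lemma lambda_ge_1:
  assumes "x \<rightarrow>\<^bsub>G\<^esub> y"
  shows "graph_lambda G \<ge> 1"
proof -
  have xy: "x \<in> verts G" "y \<in> verts G" "x \<noteq> y"
    using assms adj_verts adj_not_same by blast+
  define g where "g v = of_bool (v = x) - (of_bool (v = y) :: real)" for v
  define a where "a u v = - (of_bool (u \<rightarrow>\<^bsub>G\<^esub> v) :: real)" for u v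
  have sym: "a u v = a v u" for u v by (simp add: a_def adj_sym)
  have row: "(\<Sum>v\<in>verts G. a u v * 0) = 0 * 0" for u by simp
  have zero: "(\<Sum>v\<in>verts G. 0 * g v) = 0" by simp
  have nonzero: "\<exists>v\<in>verts G. g v \<noteq> 0"
    using xy by (intro bexI[of _ x]) (auto simp: g_def)
  obtain \<mu> f where f: "\<exists>v\<in>verts G. f v \<noteq> 0" "(\<Sum>v\<in>verts G. 0 * f v) = 0"
    "\<And>u. u \<in> verts G \<Longrightarrow> (\<Sum>v\<in>verts G. a u v * f v) = \<mu> * f u"
    "\<And>g. (\<Sum>v\<in>verts G. 0 * g v) = 0 \<Longrightarrow>
       (\<Sum>u\<in>verts G. \<Sum>v\<in>verts G. a u v * g u * g v) \<le> \<mu> * (\<Sum>v\<in>verts G. (g v)\<^sup>2)"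
    by (rule rayleigh_maximizer[of "verts G" a "\<lambda>_. 0" 0 g, OF finite_verts sym row zero nonzero], rule that)
  have sq: "(g v)\<^sup>2 = of_bool (v = x) + of_bool (v = y)" for v
    using xy(3) by (auto simp: g_def)
  have pick: "(\<Sum>v\<in>verts G. F v * g v) = F x - F y" for F :: "'a \<Rightarrow> real"
    using xy by (simp add: g_def right_diff_distrib sum_subtractf)
  have "(\<Sum>u\<in>verts G. \<Sum>v\<in>verts G. a u v * g u * g v) = (\<Sum>u\<in>verts G. (a u x - a u y) * g u)"
    unfolding pick[symmetric] by (simp add: sum_distrib_left mult_ac)
  also have "\<dots> = 2"
    unfolding pick using assms adj_sym[of y x] adj_not_same by (auto simp: a_def)
  finally have "2 \<le> \<mu> * 2"
    using f(4)[of g] xy by (simp add: sq sum.distrib)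
  then have "\<mu> \<ge> 1" by simp
  moreover have "- \<mu> \<in> set (graph_eigenvalues G)"
    by (rule eigenfunction_in_graph_eigenvalues[OF f(1)]) (use f(3) in \<open>simp add: a_def sum_negf minus_equation_iff eq_commute\<close>)
  then have "graph_eigenvalues G ! (card (verts G) - 1) \<le> - \<mu>"
    using sorted_wrt_last_le[OF graph_eigenvalues_sorted] by (simp add: length_graph_eigenvalues)
  ultimately show ?thesis by (simp add: graph_lambda_def)
qed

lemma edge_boundary_ge:
  assumes lam: "graph_lambda G < real d" and card: "card (verts G) \<ge> 2"
    and U: "U \<subseteq> verts G"
  shows "(real d - graph_lambda G) * card U * card (verts G - U) / card (verts G)
           \<le> (\<Sum>v\<in>verts G - U. card {w\<in>U. v \<rightarrow>\<^bsub>G\<^esub> w})"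
proof -
  define n where "n = real (card (verts G))"
  define u where "u = real (card U)"
  define a where "a v w = (of_bool (v \<rightarrow>\<^bsub>G\<^esub> w) :: real)" for v w
  define e where "e = (\<Sum>v\<in>verts G - U. \<Sum>w\<in>U. a v w)"
  define i where "i = (\<Sum>v\<in>U. \<Sum>w\<in>U. a v w)"
  define z where "z v = (of_bool (v \<in> U) :: real)" for v
  define c where "c = u / n"
  have finU: "finite U" by (rule rev_finite_subset[OF finite_verts U])
  have n: "n > 0" using card by (simp add: n_def)
  have rest: "(\<Sum>v\<in>verts G. F v * z v) = sum F U" for F :: "'a \<Rightarrow> real"
    using U by (simp add: z_def sum.If_cases of_bool_def if_distrib Int_absorb1 cong: if_cong)
  have z: "sum z (verts G) = u" using rest[of "\<lambda>_. 1"] by (simp add: u_def)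
  have col: "(\<Sum>v\<in>verts G. a v w) = real d" if "w \<in> verts G" for w
    using sum_adj[OF that] unfolding a_def by (subst adj_sym)
  have row: "(\<Sum>w\<in>verts G. a v w) = real d" if "v \<in> verts G" for v
    using sum_adj[OF that] unfolding a_def .
  have ei: "e + i = d * u"
  proof -
    have "(\<Sum>v\<in>verts G. \<Sum>w\<in>U. a v w) = e + i"
      using sum.subset_diff[OF U finite_verts, of "\<lambda>v. \<Sum>w\<in>U. a v w"] by (simp add: e_def i_def)
    also have "(\<Sum>v\<in>verts G. \<Sum>w\<in>U. a v w) = (\<Sum>w\<in>U. real d)"
      by (subst sum.swap) (use U in \<open>simp add: col subsetD\<close>)
    finally show ?thesis by (simp add: u_def mult.commute)
  qed
  have shift: "(\<Sum>v\<in>verts G. F v * (z v - c)) = sum F U - c * sum F (verts G)" for F :: "'a \<Rightarrow> real"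
    by (simp add: right_diff_distrib sum_subtractf rest sum_distrib_left mult.commute)
  have inner: "(\<Sum>w\<in>verts G. a v w * (z w - c)) = (\<Sum>w\<in>U. a v w) - c * d" if "v \<in> verts G" for v
    unfolding shift row[OF that] ..
  have "(\<Sum>v\<in>verts G. \<Sum>w\<in>verts G. a v w * (z v - c) * (z w - c))
      = (\<Sum>v\<in>verts G. ((\<Sum>w\<in>U. a v w) - c * d) * (z v - c))"
    by (intro sum.cong refl) (simp add: inner[symmetric] sum_distrib_left sum_distrib_right mult_ac)
  also have "\<dots> = (\<Sum>v\<in>U. (\<Sum>w\<in>U. a v w) - c * d) - c * (\<Sum>v\<in>verts G. (\<Sum>w\<in>U. a v w) - c * d)"
    by (rule shift)
  also have "(\<Sum>v\<in>verts G. (\<Sum>w\<in>U. a v w) - c * d) = d * u - c * d * n"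
    using ei sum.subset_diff[OF U finite_verts, of "\<lambda>v. \<Sum>w\<in>U. a v w"]
    by (simp add: sum_subtractf e_def i_def n_def)
  also have "(\<Sum>v\<in>U. (\<Sum>w\<in>U. a v w) - c * d) = i - c * d * u"
    by (simp add: sum_subtractf i_def u_def)
  finally have quad: "(\<Sum>v\<in>verts G. \<Sum>w\<in>verts G. a v w * (z v - c) * (z w - c)) = i - c * d * u"
    using n by (simp add: c_def)
  have "(\<Sum>v\<in>verts G. (z v - c)\<^sup>2) = (\<Sum>v\<in>verts G. z v * (1 - 2 * c) + c\<^sup>2)"
    by (intro sum.cong refl) (auto simp: z_def power2_eq_square algebra_simps)
  also have "\<dots> = u * (1 - 2 * c) + n * c\<^sup>2"
    by (simp add: sum.distrib sum_distrib_right[symmetric] z n_def)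
  also have "\<dots> = u - c * u"
    using n by (simp add: c_def power2_eq_square field_simps)
  finally have norm: "(\<Sum>v\<in>verts G. (z v - c)\<^sup>2) = u - c * u" .
  have "(\<Sum>v\<in>verts G. z v - c) = 0"
    using n by (simp add: sum_subtractf z c_def n_def[symmetric])
  then have "i - c * d * u \<le> graph_lambda G * (u - c * u)"
    using rayleigh_le_lambda[OF lam card, of "\<lambda>v. z v - c"] quad norm by (simp add: a_def)
  then have "(real d - graph_lambda G) * (u - c * u) \<le> e"
    using ei by (simp add: algebra_simps)
  moreover have "u - c * u = u * (n - u) / n"
    using n by (simp add: c_def field_simps)
  moreover have "real (card (verts G - U)) = n - u"
    using card_mono[OF finite_verts U] by (simp add: card_Diff_subset[OF finU U] n_def u_def of_nat_diff)
  moreover have "e = (\<Sum>v\<in>verts G - U. card {w\<in>U. v \<rightarrow>\<^bsub>G\<^esub> w})"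
    using finU by (simp add: e_def a_def Int_def)
  ultimately show ?thesis by (simp add: n_def u_def)
qed

end

lemma expectation_bind_pmf_finite:
  fixes h :: "'y \<Rightarrow> real"
  assumes "finite (set_pmf p)" "\<And>x. x \<in> set_pmf p \<Longrightarrow> finite (set_pmf (K x))"
  shows "measure_pmf.expectation (bind_pmf p K) h
           = measure_pmf.expectation p (\<lambda>x. measure_pmf.expectation (K x) h)"
  using assms by (subst pmf_expectation_bind[of "set_pmf p"], simp_all)
    (subst integral_measure_pmf[of "set_pmf p"], simp_all)

definition growth_invariant :: "('a, 'b) pre_digraph \<Rightarrow> nat \<Rightarrow> nat \<Rightarrow> 'a growth_state \<Rightarrow> bool" where
  "growth_invariant G d t = (\<lambda>(P, Q, U).
     P \<union> Q \<union> U = verts G \<and> P \<inter> Q = {} \<and> P \<inter> U = {} \<and> Q \<inter> U = {} \<and>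
     P \<noteq> {} \<and> (\<forall>p\<in>P. \<forall>u\<in>U. \<not> p \<rightarrow>\<^bsub>G\<^esub> u) \<and> (\<forall>q\<in>Q. \<exists>p\<in>P. q \<rightarrow>\<^bsub>G\<^esub> p) \<and>
     card P \<le> t \<and> (Q \<noteq> {} \<longrightarrow> card P = t) \<and> card Q \<le> (d - 2) * t + 2)"

lemma growth_step_nonempty:
  assumes "Q \<noteq> {}"
  shows "growth_step G (P, Q, U) = map_pmf (\<lambda>v. (insert v P, (Q - {v}) \<union> {w \<in> U. v \<rightarrow>\<^bsub>G\<^esub> w},
           U - {w \<in> U. v \<rightarrow>\<^bsub>G\<^esub> w})) (pmf_of_set Q)"
  using assms by (simp add: growth_step_def Let_def)

lemma growth_step_empty: "growth_step G (P, {}, U) = return_pmf (P, {}, U)"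
  by (simp add: growth_step_def)

context
  fixes G :: "('a, 'b) pre_digraph" and d :: nat
  assumes reg: "regular_graph G d" and d2: "d \<ge> 2"
begin

interpretation graph G
  using reg by (simp add: regular_graph_def)

lemma growth_invariant_finite:
  assumes "growth_invariant G d t (P, Q, U)"
  shows "finite P" "finite Q" "finite U"
proof -
  have "finite (P \<union> Q \<union> U)" using assms finite_verts by (simp add: growth_invariant_def)
  then show "finite P" "finite Q" "finite U" by auto
qed

lemma growth_invariant_step:
  assumes inv: "growth_invariant G d t S" and S': "S' \<in> set_pmf (growth_step G S)"
  shows "growth_invariant G d (Suc t) S'"
proof -
  obtain P Q U where S: "S = (P, Q, U)" by (cases S)
  note fin = growth_invariant_finite[OF inv[unfolded S]]
  show ?thesis
  proof (cases "Q = {}")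
    case True
    then show ?thesis using inv S' by (auto simp: S growth_invariant_def growth_step_empty)
  next
    case False
    define N where "N v = {w \<in> U. v \<rightarrow>\<^bsub>G\<^esub> w}" for v
    obtain v where v: "v \<in> Q" and S'v: "S' = (insert v P, (Q - {v}) \<union> N v, U - N v)"
      using S' unfolding S growth_step_nonempty[OF False] set_map_pmf set_pmf_of_set[OF False fin(2)]
      by (rule imageE) (rule that, assumption, simp only: N_def)
    have VPQU: "P \<union> Q \<union> U = verts G" "P \<inter> Q = {}" "P \<inter> U = {}" "Q \<inter> U = {}"
      and PU: "\<forall>p\<in>P. \<forall>u\<in>U. \<not> p \<rightarrow>\<^bsub>G\<^esub> u" and QP: "\<forall>q\<in>Q. \<exists>p\<in>P. q \<rightarrow>\<^bsub>G\<^esub> p"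
      and cP: "card P = t" and cQ: "card Q \<le> (d - 2) * t + 2"
      using inv False by (simp_all add: S growth_invariant_def)
    obtain p where p: "p \<in> P" "v \<rightarrow>\<^bsub>G\<^esub> p" using QP v by blast
    have vV: "v \<in> verts G" using VPQU v by blast
    have "N v \<subseteq> {w. v \<rightarrow>\<^bsub>G\<^esub> w} - {p}" using p VPQU(3) by (auto simp: N_def)
    then have "card (N v) \<le> card ({w. v \<rightarrow>\<^bsub>G\<^esub> w} - {p})"
      using finite_neighbours[OF reg] by (intro card_mono) auto
    also have "\<dots> = d - 1"
      using p card_neighbours[OF reg vV] by (simp add: card_Diff_singleton)
    finally have "card ((Q - {v}) \<union> N v) \<le> (card Q - 1) + (d - 1)"
      using v fin card_Un_le[of "Q - {v}" "N v"] by simp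
    moreover have "card Q \<ge> 1" using v fin by (metis card_0_eq empty_iff less_one not_le)
    ultimately have "card ((Q - {v}) \<union> N v) \<le> (d - 2) * Suc t + 2"
      using cQ d2 by simp
    moreover have "card (insert v P) = Suc t"
      using v VPQU(2) fin cP by (subst card_insert_disjoint) auto
    moreover have "\<forall>q\<in>(Q - {v}) \<union> N v. \<exists>p\<in>insert v P. q \<rightarrow>\<^bsub>G\<^esub> p"
    proof
      fix q assume "q \<in> (Q - {v}) \<union> N v"
      then show "\<exists>p\<in>insert v P. q \<rightarrow>\<^bsub>G\<^esub> p"
        using QP adj_sym[OF reg, of v q] unfolding N_def by blast
    qed
    moreover have "insert v P \<union> ((Q - {v}) \<union> N v) \<union> (U - N v) = verts G"
      unfolding VPQU(1)[symmetric] N_def using v by blast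
    moreover have "\<forall>p\<in>insert v P. \<forall>u\<in>U - N v. \<not> p \<rightarrow>\<^bsub>G\<^esub> u"
      unfolding N_def using PU by blast
    moreover have "insert v P \<inter> ((Q - {v}) \<union> N v) = {}" "insert v P \<inter> (U - N v) = {}"
      "((Q - {v}) \<union> N v) \<inter> (U - N v) = {}"
      unfolding N_def using v VPQU(2-4) by blast+
    ultimately show ?thesis by (simp add: S'v growth_invariant_def)
  qed
qed

lemma finite_set_pmf_growth_step:
  assumes "growth_invariant G d t S"
  shows "finite (set_pmf (growth_step G S))"
proof -
  obtain P Q U where S: "S = (P, Q, U)" by (cases S)
  show ?thesis
    using growth_invariant_finite[OF assms[unfolded S]]
    by (cases "Q = {}") (simp_all add: S growth_step_empty growth_step_nonempty)
qed

lemma expectation_unvisited_step: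
  assumes lam: "graph_lambda G < real d" and card: "card (verts G) \<ge> 2"
    and inv: "growth_invariant G d t (P, Q, U)"
    and r: "r * real (card Q) \<le> real t"
  shows "measure_pmf.expectation (growth_step G (P, Q, U)) (\<lambda>(P, Q, U). real (card U))
           \<le> card U * (1 - (real d - graph_lambda G) / card (verts G) * (1 + r))"
proof -
  define n where "n = real (card (verts G))"
  define N where "N v = {w \<in> U. v \<rightarrow>\<^bsub>G\<^esub> w}" for v
  note fin = growth_invariant_finite[OF inv]
  have n: "n > 0" using card by (simp add: n_def)
  have VU: "verts G - U = P \<union> Q" "U \<subseteq> verts G" "P \<inter> Q = {}"
    using inv by (auto simp: growth_invariant_def)
  have "(\<Sum>v\<in>verts G - U. card (N v)) = (\<Sum>v\<in>Q. card (N v))"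
    unfolding VU(1) using fin inv
    by (intro sum.mono_neutral_right) (auto simp: N_def growth_invariant_def)
  then have bd: "(real d - graph_lambda G) * card U * (card P + card Q) / n \<le> (\<Sum>v\<in>Q. card (N v))"
    using edge_boundary_ge[OF reg lam card VU(2)] fin VU
    by (simp add: N_def n_def card_Un_disjoint)
  show ?thesis
  proof (cases "Q = {}")
    case True
    have "card P > 0" using inv fin by (auto simp: growth_invariant_def card_gt_0_iff)
    then have "(real d - graph_lambda G) * card U \<le> 0"
      using bd True n by (simp add: divide_le_0_iff mult_le_0_iff)
    then have "card U = 0" using lam by (simp add: mult_le_0_iff)
    then show ?thesis using True by (simp add: growth_step_empty)
  next
    case False
    then have q: "real (card Q) > 0" using fin by (simp add: card_gt_0_iff)
    have P: "card P = t" using inv False by (simp add: growth_invariant_def)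
    have "measure_pmf.expectation (growth_step G (P, Q, U)) (\<lambda>(P, Q, U). real (card U))
        = (\<Sum>v\<in>Q. real (card (U - N v))) / card Q"
      using False fin by (simp add: growth_step_nonempty N_def integral_pmf_of_set)
    also have "(\<Sum>v\<in>Q. real (card (U - N v))) = (\<Sum>v\<in>Q. real (card U) - card (N v))"
    proof (intro sum.cong refl)
      fix v
      have "N v \<subseteq> U" by (auto simp: N_def)
      then show "real (card (U - N v)) = real (card U) - card (N v)"
        using fin by (simp add: card_Diff_subset finite_subset card_mono of_nat_diff)
    qed
    also have "\<dots> / card Q = card U - (\<Sum>v\<in>Q. card (N v)) / card Q"
      using q by (simp add: sum_subtractf diff_divide_distrib)
    also have "\<dots> \<le> card U - ((real d - graph_lambda G) * card U * (t + card Q) / n) / card Q"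
      using bd q P by (intro diff_left_mono divide_right_mono) auto
    also have "\<dots> = card U - (real d - graph_lambda G) / n * card U * (1 + t / card Q)"
      using q n by (simp add: field_simps)
    also have "\<dots> \<le> card U - (real d - graph_lambda G) / n * card U * (1 + r)"
    proof (intro diff_left_mono mult_left_mono)
      show "1 + r \<le> 1 + t / card Q" using r q by (simp add: field_simps)
    qed (use lam n in simp)
    finally show ?thesis by (simp add: n_def algebra_simps)
  qed
qed

lemma random_growth_one:
  "random_growth G v1 (Suc 0) = return_pmf ({v1}, {w \<in> verts G - {v1}. v1 \<rightarrow>\<^bsub>G\<^esub> w},
     verts G - {v1} - {w \<in> verts G - {v1}. v1 \<rightarrow>\<^bsub>G\<^esub> w})"
  by (simp add: bind_return_pmf growth_step_nonempty pmf_of_set_singleton)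

lemma random_growth_invariant:
  assumes v1: "v1 \<in> verts G" and t: "t \<ge> 1"
  shows "finite (set_pmf (random_growth G v1 t)) \<and>
    (\<forall>S\<in>set_pmf (random_growth G v1 t). growth_invariant G d t S)"
  using t
proof (induction t rule: nat_induct_at_least)
  case base
  define N where "N = {w \<in> verts G - {v1}. v1 \<rightarrow>\<^bsub>G\<^esub> w}"
  have "card N \<le> card {w. v1 \<rightarrow>\<^bsub>G\<^esub> w}"
    using finite_neighbours[OF reg] by (intro card_mono) (auto simp: N_def)
  then have "card N \<le> (d - 2) * 1 + 2" using card_neighbours[OF reg v1] d2 by simp
  then have "growth_invariant G d 1 ({v1}, N, verts G - {v1} - N)"
    using v1 adj_sym[OF reg] by (auto simp: growth_invariant_def N_def)
  then show ?case unfolding One_nat_def random_growth_one N_def by simp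
next
  case (Suc t)
  then show ?case
    using growth_invariant_step finite_set_pmf_growth_step by auto
qed

lemma expectation_unvisited_Suc:
  assumes lam: "graph_lambda G < real d" and card: "card (verts G) \<ge> 2"
    and v1: "v1 \<in> verts G" and t: "t \<ge> 1"
    and r: "r \<ge> 0" "r * (real (d - 2) * t + 2) \<le> t"
  shows "measure_pmf.expectation (random_growth G v1 (Suc t)) (\<lambda>(P, Q, U). real (card U))
    \<le> measure_pmf.expectation (random_growth G v1 t) (\<lambda>(P, Q, U). real (card U))
        * (1 - (real d - graph_lambda G) / card (verts G) * (1 + r))"
proof -
  let ?p = "random_growth G v1 t"
  let ?u = "\<lambda>(P, Q, U). real (card U)"
  let ?c = "1 - (real d - graph_lambda G) / card (verts G) * (1 + r)"
  have fin: "finite (set_pmf ?p)" and inv: "\<And>S. S \<in> set_pmf ?p \<Longrightarrow> growth_invariant G d t S"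
    using random_growth_invariant[OF v1 t] by auto
  have "measure_pmf.expectation (random_growth G v1 (Suc t)) ?u
      = measure_pmf.expectation ?p (\<lambda>S. measure_pmf.expectation (growth_step G S) ?u)"
    unfolding random_growth.simps
    by (rule expectation_bind_pmf_finite[OF fin finite_set_pmf_growth_step[OF inv]])
  also have "\<dots> \<le> measure_pmf.expectation ?p (\<lambda>S. ?u S * ?c)"
  proof (rule integral_mono_AE)
    show "AE S in measure_pmf ?p. measure_pmf.expectation (growth_step G S) ?u \<le> ?u S * ?c"
    proof (rule AE_pmfI)
      fix S assume "S \<in> set_pmf ?p"
      note inv = inv[OF this]
      obtain P Q U where S: "S = (P, Q, U)" by (cases S)
      have "card Q \<le> (d - 2) * t + 2" using inv by (simp add: S growth_invariant_def)
      then have "real (card Q) \<le> real (d - 2) * t + 2"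
        by (metis of_nat_add of_nat_le_iff of_nat_mult of_nat_numeral)
      then have "r * card Q \<le> t" using mult_left_mono[OF _ r(1)] r(2) by fastforce
      then show "measure_pmf.expectation (growth_step G S) ?u \<le> ?u S * ?c"
        using expectation_unvisited_step[OF lam card inv[unfolded S]] by (simp add: S)
    qed
  qed (intro integrable_measure_pmf_finite fin)+
  also have "\<dots> = measure_pmf.expectation ?p ?u * ?c" by simp
  finally show ?thesis .
qed

end

lemma one_minus_le_exp: "1 - x \<le> exp (- x)" for x :: real
  using exp_ge_add_one_self[of "- x"] by simp

context
  fixes G :: "('a, 'b) pre_digraph" and d :: nat and v1 :: 'a
  assumes reg: "regular_graph G d" and d2: "d \<ge> 2"
    and lam: "graph_lambda G < real d" and card: "card (verts G) \<ge> 2"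
    and v1: "v1 \<in> verts G"
begin

interpretation graph G
  using reg by (simp add: regular_graph_def)

abbreviation expected_unvisited :: "nat \<Rightarrow> real" where
  "expected_unvisited t \<equiv> measure_pmf.expectation (random_growth G v1 t) (\<lambda>(P, Q, U). real (card U))"

lemma expected_unvisited_one:
  "expected_unvisited (Suc 0) = real (card (verts G)) - (real d + 1)"
proof -
  have "verts G - {v1} - {w \<in> verts G - {v1}. v1 \<rightarrow>\<^bsub>G\<^esub> w} = verts G - insert v1 {w. v1 \<rightarrow>\<^bsub>G\<^esub> w}"
    by auto
  moreover have sub: "insert v1 {w. v1 \<rightarrow>\<^bsub>G\<^esub> w} \<subseteq> verts G"
    using v1 adj_verts[OF reg] by auto
  moreover have "card (insert v1 {w. v1 \<rightarrow>\<^bsub>G\<^esub> w}) = d + 1"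
    using finite_neighbours[OF reg] card_neighbours[OF reg v1] adj_not_same by (subst card_insert_disjoint) auto
  ultimately show ?thesis
    unfolding random_growth_one[OF reg d2] using card_mono[OF finite_verts sub] finite_neighbours[OF reg]
    by (simp add: card_Diff_subset of_nat_diff)
qed

lemma expected_unvisited_le:
  "expected_unvisited t \<le> card (verts G) *
     exp (- (real d - graph_lambda G) * (1 + 1 / (real d - 1)) * (real t / card (verts G)))"
proof -
  define n where "n = real (card (verts G))"
  define \<delta> where "\<delta> = (real d - graph_lambda G) / n"
  define a where "a = \<delta> * (1 + 1 / (real d - 1))"
  have n: "n > 0" using card by (simp add: n_def)
  have dr: "real d \<ge> 2" using d2 by simp
  have \<delta>: "\<delta> \<ge> 0" using lam n by (simp add: \<delta>_def)
  obtain w where "v1 \<rightarrow>\<^bsub>G\<^esub> w"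
  proof -
    have "{w. v1 \<rightarrow>\<^bsub>G\<^esub> w} \<noteq> {}" using card_neighbours[OF reg v1] d2 by force
    then show ?thesis using that by blast
  qed
  then have "graph_lambda G \<ge> 1" by (rule lambda_ge_1[OF reg])
  then have \<delta>_le: "\<delta> \<le> (real d - 1) / n" using n by (simp add: \<delta>_def divide_right_mono)
  have nonneg: "expected_unvisited t \<ge> 0" for t
    by (rule integral_nonneg_AE) auto
  have one: "expected_unvisited 1 = n * (1 - (d + 1) / n)"
    using n unfolding One_nat_def expected_unvisited_one n_def[symmetric] by (simp add: right_diff_distrib)
  have a_le: "a \<le> (d + 1) / n"
  proof -
    have "a \<le> (real d - 1) / n * (1 + 1 / (real d - 1))"
      unfolding a_def using \<delta>_le dr by (intro mult_right_mono) auto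
    also have "\<dots> = d / n" using dr n by (simp add: field_simps)
    also have "\<dots> \<le> (d + 1) / n" using n by (simp add: divide_right_mono)
    finally show ?thesis .
  qed
  have bound: "expected_unvisited t \<le> n * exp (- (a * t))"
  proof -
    consider "t = 0" | "t = 1" | "t \<ge> 2" by linarith
    then show ?thesis
    proof cases
      case 1
      have "card (verts G - {v1}) \<le> card (verts G)" by (intro card_mono) auto
      then show ?thesis by (simp add: 1 n_def)
    next
      case 2
      have "1 - (d + 1) / n \<le> exp (- ((d + 1) / n))" by (rule one_minus_le_exp)
      also have "\<dots> \<le> exp (- a)" using a_le by simp
      finally show ?thesis unfolding 2 one using n by simp
    next
      case 3
      then show ?thesis
      proof (induction t rule: nat_induct_at_least)
        case base
        \<comment> \<open>At \<open>t = 1\<close> the queue has \<open>d\<close> vertices, which only gives the factor \<open>1 + 1 / d\<close>;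
          the exact value at \<open>t = 1\<close> makes up for the difference.\<close>
        define x where "x = (d + 1) / n"
        define y where "y = \<delta> * (1 + 1 / d)"
        have "expected_unvisited 2 \<le> expected_unvisited 1 * (1 - y)"
          using expectation_unvisited_Suc[OF reg d2 lam card v1, of 1 "1 / d"] d2
          by (simp add: y_def \<delta>_def n_def numeral_2_eq_2 of_nat_diff)
        also have "\<dots> \<le> expected_unvisited 1 * exp (- y)"
          by (intro mult_left_mono one_minus_le_exp nonneg)
        also have "\<dots> \<le> n * exp (- x) * exp (- y)"
          unfolding one x_def[symmetric]
          using n one_minus_le_exp[of x] by (intro mult_right_mono) auto
        also have "\<dots> = n * exp (- (x + y))" by (simp add: exp_add[symmetric])
        also have "\<dots> \<le> n * exp (- (a * real 2))"
        proof -
          have "x \<ge> \<delta> * (d + 1) / (real d - 1)"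
          proof -
            have "\<delta> * (d + 1) / (real d - 1) \<le> (real d - 1) / n * (d + 1) / (real d - 1)"
              using \<delta>_le dr by (intro divide_right_mono mult_right_mono) auto
            also have "\<dots> = x" using dr by (simp add: x_def)
            finally show ?thesis .
          qed
          then have "x + y \<ge> \<delta> * ((d + 1) / (real d - 1) + (1 + 1 / d))"
            by (simp add: y_def algebra_simps)
          moreover have "(d + 1) / (real d - 1) + (1 + 1 / d) \<ge> 2 * (1 + 1 / (real d - 1))"
            using dr by (simp add: divide_simps) (simp add: algebra_simps)
          then have "\<delta> * ((d + 1) / (real d - 1) + (1 + 1 / d)) \<ge> a * 2"
            using mult_left_mono[OF _ \<delta>] unfolding a_def mult.assoc by (metis mult.commute)
          ultimately show ?thesis using n by simp
        qed
        finally show ?case .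
      next
        case (Suc t)
        have "1 / (real d - 1) * (real (d - 2) * t + 2) \<le> t"
          using Suc.hyps d2 by (simp add: divide_simps of_nat_diff) (simp add: algebra_simps)
        then have "expected_unvisited (Suc t) \<le> expected_unvisited t * (1 - a)"
          using expectation_unvisited_Suc[OF reg d2 lam card v1, of t "1 / (real d - 1)"] Suc.hyps dr
          by (simp add: a_def \<delta>_def n_def)
        also have "\<dots> \<le> expected_unvisited t * exp (- a)"
          by (intro mult_left_mono one_minus_le_exp nonneg)
        also have "\<dots> \<le> n * exp (- (a * t)) * exp (- a)"
          using Suc.IH by (intro mult_right_mono) auto
        also have "\<dots> = n * exp (- (a * Suc t))"
          by (simp add: exp_add[symmetric] algebra_simps)
        finally show ?case .
      qed
    qed
  qed
  have "a * t = (real d - graph_lambda G) * (1 + 1 / (real d - 1)) * (t / n)"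
    by (simp add: a_def \<delta>_def)
  with bound show ?thesis by (simp only: n_def mult_minus_left)
qed

lemma expected_queue_ge:
  "measure_pmf.expectation (random_growth G v1 t) (\<lambda>(P, Q, U). real (card Q))
     \<ge> real (card (verts G)) - t - expected_unvisited t"
proof -
  let ?p = "random_growth G v1 t"
  have *: "finite (set_pmf ?p) \<and> (\<forall>(P, Q, U)\<in>set_pmf ?p. card (verts G) \<le> card Q + card U + t)"
  proof (cases "t = 0")
    case True
    then show ?thesis using v1 by (simp add: card_Diff_singleton)
  next
    case False
    then have t: "t \<ge> 1" by simp
    have "card (verts G) \<le> card Q + card U + t" if S: "(P, Q, U) \<in> set_pmf ?p" for P Q U
    proof -
      have inv: "growth_invariant G d t (P, Q, U)"
        using random_growth_invariant[OF reg d2 v1 t] S by auto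
      then have "card (verts G) = card (P \<union> Q \<union> U)" by (simp add: growth_invariant_def)
      also have "\<dots> \<le> card P + card Q + card U"
        using card_Un_le[of "P \<union> Q" U] card_Un_le[of P Q] by linarith
      finally show ?thesis using inv by (simp add: growth_invariant_def)
    qed
    then show ?thesis using random_growth_invariant[OF reg d2 v1 t] by auto
  qed
  then have fin: "finite (set_pmf ?p)" by blast
  have "measure_pmf.expectation ?p (\<lambda>(P, Q, U). real (card (verts G)) - t - card U)
      \<le> measure_pmf.expectation ?p (\<lambda>(P, Q, U). real (card Q))"
    using * by (intro integral_mono_AE integrable_measure_pmf_finite fin AE_pmfI) force
  moreover have "measure_pmf.expectation ?p (\<lambda>(P, Q, U). real (card (verts G)) - t - card U)
      = measure_pmf.expectation ?p (\<lambda>S. (real (card (verts G)) - t) - (case S of (P, Q, U) \<Rightarrow> real (card U)))"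
    by (simp add: case_prod_unfold)
  moreover have "\<dots> = real (card (verts G)) - t - expected_unvisited t"
    by (subst Bochner_Integration.integral_diff) (auto intro: integrable_measure_pmf_finite fin)
  ultimately show ?thesis by simp
qed

end

theorem mainTheorem3:
  fixes G :: "('a, 'b) pre_digraph" and d n t :: nat and v1 :: 'a and \<pi> :: real
  assumes "regular_graph G d"
    and "n = card (verts G)"
    and "graph_lambda G < real d"
    and "v1 \<in> verts G"
    and "t \<le> n"
    and "\<pi> = real t / real n"
  shows "measure_pmf.expectation (random_growth G v1 t) (\<lambda>(P, Q, U). real (card Q) / real n)
           \<ge> 1 - \<pi> - exp (- (real d - graph_lambda G) * (1 + 1 / (real d - 1)) * \<pi>)"
proof -
  interpret graph G using assms(1) by (simp add: regular_graph_def)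
  have "n > 0" using assms(2,4) finite_verts by (auto simp: card_gt_0_iff)
  have nonneg: "measure_pmf.expectation (random_growth G v1 t) (\<lambda>(P, Q, U). real (card Q) / real n) \<ge> 0"
    by (rule integral_nonneg_AE) auto
  show ?thesis
  proof (cases "n = 1")
    case True
    then consider "t = 0" | "t = 1" using assms(5) by linarith
    then show ?thesis
    proof cases
      case 1
      then show ?thesis using nonneg assms(6) by simp
    next
      case 2
      then have "1 - \<pi> = 0" using True assms(6) by simp
      then show ?thesis using nonneg by (simp add: order_trans[OF _ nonneg])
    qed
  next
    case False
    then have card: "card (verts G) \<ge> 2" using \<open>n > 0\<close> assms(2) by linarith
    have "d \<noteq> 0" using assms(3) by (auto simp: graph_lambda_def)
    then have "{w. v1 \<rightarrow>\<^bsub>G\<^esub> w} \<noteq> {}" using card_neighbours[OF assms(1,4)] by force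
    then obtain w where "v1 \<rightarrow>\<^bsub>G\<^esub> w" by blast
    then have "graph_lambda G \<ge> 1" by (rule lambda_ge_1[OF assms(1)])
    then have d2: "d \<ge> 2" using assms(3) by linarith
    note params = assms(1) d2 assms(3) card assms(4)
    have n: "real n > 0" using \<open>n > 0\<close> by simp
    have "real n - t - n * exp (- (real d - graph_lambda G) * (1 + 1 / (real d - 1)) * \<pi>)
        \<le> measure_pmf.expectation (random_growth G v1 t) (\<lambda>(P, Q, U). real (card Q))"
      using expected_queue_ge[OF params, of t] expected_unvisited_le[OF params, of t]
      by (simp add: assms(2,6))
    also have "\<dots> = n * measure_pmf.expectation (random_growth G v1 t) (\<lambda>(P, Q, U). real (card Q) / real n)"
      using n by (simp add: case_prod_unfold)
    finally have "n * (1 - \<pi> - exp (- (real d - graph_lambda G) * (1 + 1 / (real d - 1)) * \<pi>))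
        \<le> n * measure_pmf.expectation (random_growth G v1 t) (\<lambda>(P, Q, U). real (card Q) / real n)"
      using n by (simp add: assms(6) right_diff_distrib)
    then show ?thesis using n by (simp only: mult_le_cancel_left_pos)
  qed
qed

end
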